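(* Let $\mathcal{F}$ be a class of graphs and let $n$ be a nonnegative integer. Then $\operatorname{ad}(\mathcal{F}^{+n})=\operatorname{ad}(\mathcal{F})$.
   Context: All graphs are finite. For a class $\mathcal{F}$ of graphs and a nonnegative integer $n$, $\mathcal{F}^{+n}$ is the class of graphs $G$ for which there exists $Z\subseteq V(G)$ with $|Z|\le n$ such that $G-Z\in\mathcal{F}$. For a graph $G$ and $x,y\in V(G)$, $d_G(x,y)$ is the minimum number of edges of a path in $G$ between $x$ and $y$. For a nonnegative integer $n$, an $n$-dimensional control function for a class $\mathcal{F}$ of graphs is a function $f:\mathbb{R}^+\to\mathbb{R}^+$ such that for every $G\in\mathcal{F}$ and every real $r>0$ there exist collections $\mathcal{U}_1,\dots,\mathcal{U}_{n+1}$ of subsets of $V(G)$ covering $V(G)$, such that for each $i$, whenever $U\neq U'$ are in $\mathcal{U}_i$ and $x\in U$, $x'\in U'$, we have $d_G(x,x')>r$, and whenever $x,x'$ lie in a common $U\in\mathcal{U}_i$ we have $d_G(x,x')\le f(r)$. The asymptotic dimension $\operatorname{ad}(\mathcal{F})$ is the minimum $n$ for which there is a common $n$-dimensional control function for all graphs in $\mathcal{F}$. *)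

theory Defs
  imports
    "Graph_Theory.Pair_Digraph"
    "Graph_Theory.Digraph_Component"
    "HOL-Library.Extended_Real"
begin

text \<open>
  A finite simple graph is a pair digraph satisfying \<^locale>\<open>pair_graph\<close>: finite, loopless and
  symmetric, every undirected edge being represented by its two opposite arcs. A path
  traverses one arc per undirected edge, so the number of its edges is the length of its arc list.
  A class of graphs is a set of such graphs over some vertex type; no closure under
  isomorphism is imposed.
\<close>

definition delete_verts :: "'a pair_pre_digraph \<Rightarrow> 'a set \<Rightarrow> 'a pair_pre_digraph" where
  "delete_verts G Z =
     \<lparr> pverts = pverts G - Z, parcs = {(u, v) \<in> parcs G. u \<notin> Z \<and> v \<notin> Z} \<rparr>"

lemma with_proj_delete_verts:
  assumes "pair_graph G"
  shows "with_proj (delete_verts G Z) = with_proj G \<restriction> (pverts G - Z)"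
proof -
  interpret pair_graph G by (rule assms)
  show ?thesis
    by (auto simp: delete_verts_def with_proj_def induce_subgraph_def
        dest: arc_fst_in_verts arc_snd_in_verts)
qed

definition plus_class :: "'a pair_pre_digraph set \<Rightarrow> nat \<Rightarrow> 'a pair_pre_digraph set"
  (\<open>_\<^bsup>+_\<^esup>\<close> [1000, 0] 1000) where
  "\<F>\<^bsup>+n\<^esup> = {G. pair_graph G \<and> (\<exists>Z \<subseteq> pverts G. card Z \<le> n \<and> delete_verts G Z \<in> \<F>)}"

text \<open>The distance is \<open>\<infinity>\<close>, the infimum of the empty set, when no path exists.\<close>

definition graph_dist :: "'a pair_pre_digraph \<Rightarrow> 'a \<Rightarrow> 'a \<Rightarrow> enat" where
  "graph_dist G x y = (INF p \<in> {p. pre_digraph.apath (with_proj G) x p y}. enat (length p))"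

text \<open>
  Only the values of \<open>f\<close> on the positive reals matter. The collections are
  \<open>\<U> 1, \<dots>, \<U> (n + 1)\<close>.
\<close>

definition control_function ::
    "nat \<Rightarrow> 'a pair_pre_digraph set \<Rightarrow> (real \<Rightarrow> real) \<Rightarrow> bool" where
  "control_function n \<F> f \<longleftrightarrow>
     (\<forall>r>0. f r > 0) \<and>
     (\<forall>G\<in>\<F>. \<forall>r>0. \<exists>\<U> :: nat \<Rightarrow> 'a set set.
        (\<forall>i\<in>{1..n+1}. \<U> i \<subseteq> Pow (pverts G)) \<and>
        (\<Union>i\<in>{1..n+1}. \<Union>(\<U> i)) = pverts G \<and>
        (\<forall>i\<in>{1..n+1}.
           (\<forall>U\<in>\<U> i. \<forall>U'\<in>\<U> i. U \<noteq> U' \<longrightarrow>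
              (\<forall>x\<in>U. \<forall>x'\<in>U'. ereal_of_enat (graph_dist G x x') > ereal r)) \<and>
           (\<forall>U\<in>\<U> i. \<forall>x\<in>U. \<forall>x'\<in>U. ereal_of_enat (graph_dist G x x') \<le> ereal (f r))))"

text \<open>
  The infimum in \<^typ>\<open>enat\<close> of a nonempty set is its minimum; the asymptotic dimension is
  \<open>\<infinity>\<close> when there is no control function of any dimension.
\<close>

definition asymptotic_dimension :: "'a pair_pre_digraph set \<Rightarrow> enat" where
  "asymptotic_dimension \<F> = Inf {enat n | n. \<exists>f. control_function n \<F> f}"

end

theory Submission
  imports Defs
begin

text \<open>
  Restoring one deleted vertex \<open>z\<close> suffices, by induction on \<open>n\<close>. Take a cover of \<open>G - z\<close>
  with the required properties at scale \<open>r\<close> and, in each of its collections, merge all the sets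
  that meet the ball of radius \<open>r\<close> around \<open>z\<close> into a single set, to which \<open>z\<close> is added. Every
  point of the merged set is within \<open>f r + r\<close> of \<open>z\<close>, hence its diameter is at most
  \<open>2 * f r + 2 * r\<close>. A path of length at most \<open>r\<close> between two different sets of the new
  collection cannot avoid \<open>z\<close>, since it would then be a path of \<open>G - z\<close>; but if it meets \<open>z\<close>,
  then both of its ends lie in the ball, and both sets were merged.
\<close>

section \<open>Covers of one graph at one scale\<close>

definition near :: "'a pair_pre_digraph \<Rightarrow> real \<Rightarrow> 'a \<Rightarrow> 'a \<Rightarrow> bool" where
  "near G r x y \<longleftrightarrow> ereal_of_enat (graph_dist G x y) \<le> ereal r"

text \<open>Isolates one graph and one scale, with a free number \<open>R\<close> in place of
  \<open>f r\<close>, so that the bound can grow from step to step. Both metric conditions go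
  through \<open>near\<close>: it fails at \<open>r\<close> between different sets and holds at
  \<open>R\<close> within a set.\<close>

definition has_cover :: "nat \<Rightarrow> 'a pair_pre_digraph \<Rightarrow> real \<Rightarrow> real \<Rightarrow> bool" where
  "has_cover m G r R \<longleftrightarrow>
     (\<exists>\<U> :: nat \<Rightarrow> 'a set set.
        (\<forall>i\<in>{1..m+1}. \<U> i \<subseteq> Pow (pverts G)) \<and>
        (\<Union>i\<in>{1..m+1}. \<Union>(\<U> i)) = pverts G \<and>
        (\<forall>i\<in>{1..m+1}.
           (\<forall>U\<in>\<U> i. \<forall>U'\<in>\<U> i. U \<noteq> U' \<longrightarrow> (\<forall>x\<in>U. \<forall>x'\<in>U'. \<not> near G r x x')) \<and>
           (\<forall>U\<in>\<U> i. \<forall>x\<in>U. \<forall>x'\<in>U. near G R x x')))"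

lemma control_function_iff_has_cover:
  "control_function m \<F> f \<longleftrightarrow>
     (\<forall>r>0. f r > 0) \<and> (\<forall>G\<in>\<F>. \<forall>r>0. has_cover m G r (f r))"
  by (simp add: control_function_def has_cover_def near_def not_le)

lemma near_mono: "near G r x y \<Longrightarrow> r \<le> s \<Longrightarrow> near G s x y"
  unfolding near_def by (meson ereal_less_eq(3) order_trans)

lemma has_cover_mono:
  assumes "has_cover m G r R" "R \<le> S"
  shows "has_cover m G r S"
  \<comment> \<open>\<open>R\<close> occurs only positively, in the diameter clause, so the rules
    descend through the formula to that one change.\<close>
  using assms(1) unfolding has_cover_def Ball_def
  by (elim ex_forward conj_forward all_forward imp_forward) (simp_all add: near_mono[OF _ assms(2)])

section \<open>Distances measured by walks\<close>

context wf_digraph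
begin

text \<open>The arcs of a path are distinct and all occur in the given walk, so counting arcs
  suffices.\<close>

lemma length_awalk_to_apath:
  assumes "awalk u p v"
  shows "length (awalk_to_apath p) \<le> length p"
proof -
  have "apath u (awalk_to_apath p) v"
    using assms by (rule apath_awalk_to_apath)
  then have "distinct (awalk_to_apath p)"
    unfolding apath_def by (auto intro: distinct_verts_imp_distinct)
  then have "length (awalk_to_apath p) = card (set (awalk_to_apath p))"
    by (simp add: distinct_card)
  also have "\<dots> \<le> card (set p)"
    using awalk_to_apath_subset[OF assms] by (simp add: card_mono)
  also have "\<dots> \<le> length p"
    by (rule card_length)
  finally show ?thesis .
qed

end

context pair_wf_digraph
begin

text \<open>Paths are not closed under concatenation, walks are; this makes the triangle inequality
  and splitting at a vertex immediate.\<close>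

lemma near_iff_awalk: "near G r x y \<longleftrightarrow> (\<exists>p. awalk x p y \<and> real (length p) \<le> r)"
proof
  assume near: "near G r x y"
  define P where "P = {p. apath x p y}"
  have dist: "graph_dist G x y = (INF p \<in> P. enat (length p))"
    by (simp add: graph_dist_def P_def)
  \<comment> \<open>A finite distance is the infimum of a nonempty set, and \<open>enat\<close> is
    well-ordered, so some path attains it.\<close>
  have "graph_dist G x y \<noteq> \<infinity>"
    using near unfolding near_def by (intro notI) simp
  then have "P \<noteq> {}"
    unfolding dist by (auto simp: top_enat_def)
  then have "graph_dist G x y \<in> (\<lambda>p. enat (length p)) ` P"
    unfolding dist by (auto intro: wellorder_InfI)
  then obtain p where "apath x p y" "graph_dist G x y = enat (length p)"
    by (auto simp: P_def)
  then show "\<exists>p. awalk x p y \<and> real (length p) \<le> r"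
    using near by (auto simp: near_def intro: awalkI_apath)
next
  assume "\<exists>p. awalk x p y \<and> real (length p) \<le> r"
  then obtain p where p: "awalk x p y" "real (length p) \<le> r"
    by blast
  have "graph_dist G x y \<le> enat (length (awalk_to_apath p))"
    unfolding graph_dist_def using p(1) by (intro INF_lower) (simp add: apath_awalk_to_apath)
  also have "\<dots> \<le> enat (length p)"
    using length_awalk_to_apath[OF p(1)] by simp
  finally have "ereal_of_enat (graph_dist G x y) \<le> ereal_of_enat (enat (length p))"
    by (simp only: ereal_of_enat_le_iff)
  then show "near G r x y"
    unfolding near_def using p(2) order_trans by fastforce
qed

lemma near_refl: "x \<in> pverts G \<Longrightarrow> 0 \<le> r \<Longrightarrow> near G r x x"
  unfolding near_iff_awalk by (intro exI[of _ "[]"]) (simp add: awalk_Nil_iff)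

lemma near_trans:
  assumes "near G r x y" "near G s y z"
  shows "near G (r + s) x z"
proof -
  obtain p q where "awalk x p y" "real (length p) \<le> r" "awalk y q z" "real (length q) \<le> s"
    using assms unfolding near_iff_awalk by blast
  then show ?thesis
    unfolding near_iff_awalk by (intro exI[of _ "p @ q"]) (auto intro: awalk_appendI)
qed

lemma pair_wf_digraph_delete_verts: "pair_wf_digraph (delete_verts G Z)"
  by unfold_locales (auto simp: delete_verts_def dest: in_arcsD1 in_arcsD2)

lemma awalk_delete_verts:
  assumes "awalk x p y" "set (pawalk_verts x p) \<inter> Z = {}"
  shows "pre_digraph.awalk (with_proj (delete_verts G Z)) x p y"
  using assms
proof (induction p arbitrary: x)
  case Nil
  then show ?case
    by (auto simp add: pre_digraph.awalk_def delete_verts_def)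
next
  case (Cons e p)
  obtain u v where e: "e = (u, v)"
    by (cases e)
  have "pre_digraph.awalk (with_proj (delete_verts G Z)) v p y"
    using Cons e by (auto simp: awalk_Cons_iff)
  \<comment> \<open>The walk from the induction hypothesis starts at a vertex of the smaller
    graph.\<close>
  moreover have "v \<notin> Z"
    using calculation by (auto simp: pre_digraph.awalk_def delete_verts_def)
  ultimately show ?case
    using Cons.prems e by (auto simp: pre_digraph.awalk_def delete_verts_def)
qed

lemma awalk_of_delete_verts:
  assumes "pre_digraph.awalk (with_proj (delete_verts G Z)) x p y"
  shows "awalk x p y"
  using assms by (auto simp: pre_digraph.awalk_def delete_verts_def)

lemma near_of_delete_verts: "near (delete_verts G Z) r x y \<Longrightarrow> near G r x y"
  unfolding near_iff_awalk pair_wf_digraph.near_iff_awalk[OF pair_wf_digraph_delete_verts]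
  by (blast intro: awalk_of_delete_verts)

text \<open>A short walk either avoids \<open>z\<close> and survives its deletion, or splits at
  \<open>z\<close> into two walks that are no longer.\<close>

lemma near_cases:
  assumes "near G r x y"
  obtains "near (delete_verts G {z}) r x y" | "near G r x z" "near G r z y"
proof -
  obtain p where p: "awalk x p y" "real (length p) \<le> r"
    using assms unfolding near_iff_awalk by blast
  show thesis
  proof (cases "z \<in> set (pawalk_verts x p)")
    case True
    then obtain q s where qs: "p = q @ s" "awalk x q z" "awalk z s y"
      using awalk_decomp[OF p(1)] by blast
    have "near G r x z"
      unfolding near_iff_awalk using qs p(2) by (intro exI[of _ q]) simp
    moreover have "near G r z y"
      unfolding near_iff_awalk using qs p(2) by (intro exI[of _ s]) simp
    ultimately show thesis
      by (rule that(2))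
  next
    case False
    then have "near (delete_verts G {z}) r x y"
      using p awalk_delete_verts[of x p y "{z}"]
      by (auto simp: pair_wf_digraph.near_iff_awalk[OF pair_wf_digraph_delete_verts])
    then show thesis
      by (rule that(1))
  qed
qed

end

lemma length_rev_path [simp]: "length (rev_path p) = length p"
  by (induction p) auto

lemma (in pair_sym_digraph) near_sym:
  assumes "near G r x y"
  shows "near G r y x"
proof -
  obtain p where "awalk x p y" "real (length p) \<le> r"
    using assms unfolding near_iff_awalk by blast
  then show ?thesis
    unfolding near_iff_awalk by (intro exI[of _ "rev_path p"]) simp
qed

section \<open>Restoring one vertex\<close>

lemma (in pair_sym_digraph) has_cover_restore_vertex:
  assumes z: "z \<in> pverts G" and "0 \<le> r" "0 \<le> R"
    and cover: "has_cover m (delete_verts G {z}) r R"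
  shows "has_cover m G r (2 * R + 2 * r)"
proof -
  let ?H = "delete_verts G {z}"
  have vertsH: "pverts ?H = pverts G - {z}"
    by (simp add: delete_verts_def)
  obtain \<U> where \<U>:
      "\<forall>i\<in>{1..m+1}. \<U> i \<subseteq> Pow (pverts G - {z})"
      "(\<Union>i\<in>{1..m+1}. \<Union>(\<U> i)) = pverts G - {z}"
      "\<forall>i\<in>{1..m+1}.
         (\<forall>U\<in>\<U> i. \<forall>U'\<in>\<U> i. U \<noteq> U' \<longrightarrow> (\<forall>x\<in>U. \<forall>x'\<in>U'. \<not> near ?H r x x')) \<and>
         (\<forall>U\<in>\<U> i. \<forall>x\<in>U. \<forall>x'\<in>U. near ?H R x x')"
    using cover unfolding has_cover_def vertsH by (elim exE conjE)
  have disj: "\<not> near ?H r x x'"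
    if "i \<in> {1..m+1}" "U \<in> \<U> i" "U' \<in> \<U> i" "U \<noteq> U'" "x \<in> U" "x' \<in> U'" for i U U' x x'
    using bspec[OF \<U>(3) that(1)] that by simp
  have diam: "near ?H R x x'"
    if "i \<in> {1..m+1}" "U \<in> \<U> i" "x \<in> U" "x' \<in> U" for i U x x'
    using bspec[OF \<U>(3) that(1)] that by simp
  define B where "B = {y. near G r z y}"
  \<comment> \<open>If no set meets the ball, this is just {z}; thus \<open>z\<close> is covered in
    every collection.\<close>
  define M where "M i = insert z (\<Union>{U \<in> \<U> i. U \<inter> B \<noteq> {}})" for i
  define \<V> where "\<V> i = insert (M i) {U \<in> \<U> i. U \<inter> B = {}}" for i
  \<comment> \<open>\<open>R\<close> leads from \<open>x\<close> to a point \<open>y\<close> of the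
    ball in the same old set, and \<open>r\<close> from \<open>y\<close> to
    \<open>z\<close>.\<close>
  have Mz: "near G (R + r) x z" if i: "i \<in> {1..m+1}" and x: "x \<in> M i" for i x
  proof (cases "x = z")
    case True
    then show ?thesis
      using z assms(2,3) by (simp add: near_refl)
  next
    case False
    then obtain U y where "U \<in> \<U> i" "x \<in> U" "y \<in> U" "near G r z y"
      using x by (auto simp: M_def B_def)
    then show ?thesis
      using near_trans[OF near_of_delete_verts[OF diam[OF i]] near_sym] by simp
  qed
  have M_far: "\<not> near G r x x'"
    if i: "i \<in> {1..m+1}" and x: "x \<in> M i" and U': "U' \<in> \<U> i" "U' \<inter> B = {}" "x' \<in> U'" for i x x' U'
  proof
    assume "near G r x x'"
    then show False
    proof (cases rule: near_cases[of r x x' z])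
      case 1
      \<comment> \<open>\<open>z\<close> belongs to no old set, so \<open>x = z\<close> is separate:
        then \<open>x'\<close> itself lies in the ball. Otherwise two different old sets would be
        close in \<open>?H\<close>.\<close>
      show False
      proof (cases "x = z")
        case True
        then show False
          using \<open>near G r x x'\<close> U' by (auto simp: B_def)
      next
        case False
        then obtain U where "U \<in> \<U> i" "x \<in> U" "U \<inter> B \<noteq> {}"
          using x by (auto simp: M_def)
        then show False
          using disj[OF i _ U'(1) _ _ U'(3), of U x] 1 U'(2) by auto
      qed
    next
      case 2
      then show False
        using U' by (auto simp: B_def)
    qed
  qed
  \<comment> \<open>It is enough that \<open>U'\<close> misses the ball: a short walk through
    \<open>z\<close> would put \<open>x'\<close> into it.\<close>
  have far: "\<not> near G r x x'"
    if "i \<in> {1..m+1}" "U \<in> \<U> i" "x \<in> U" "U' \<in> \<U> i" "U' \<inter> B = {}" "x' \<in> U'" "U \<noteq> U'" for i x x' U U'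
  proof
    assume "near G r x x'"
    then show False
      by (cases rule: near_cases[of r x x' z]) (use that disj in \<open>auto simp: B_def\<close>)
  qed
  show ?thesis
    unfolding has_cover_def
  proof (intro exI[of _ \<V>] conjI ballI impI)
    show "\<V> i \<subseteq> Pow (pverts G)" if "i \<in> {1..m+1}" for i
      using \<U>(1) that z by (fastforce simp: \<V>_def M_def)
    have "\<Union>(\<V> i) = insert z (\<Union>(\<U> i))" for i
      by (auto simp: \<V>_def M_def)
    then have "(\<Union>i\<in>{1..m+1}. \<Union>(\<V> i)) = insert z (\<Union>i\<in>{1..m+1}. \<Union>(\<U> i))"
      by auto
    then show "(\<Union>i\<in>{1..m+1}. \<Union>(\<V> i)) = pverts G"
      using \<U>(2) z by auto
    show "\<not> near G r x x'"
      if "i \<in> {1..m+1}" "U \<in> \<V> i" "U' \<in> \<V> i" "U \<noteq> U'" "x \<in> U" "x' \<in> U'" for i U U' x x'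
      \<comment> \<open>Of two different members at most one is \<open>M i\<close>; symmetry lets it
        come first.\<close>
      using that M_far far near_sym unfolding \<V>_def by blast
    show "near G (2 * R + 2 * r) x x'"
      if i: "i \<in> {1..m+1}" and U: "U \<in> \<V> i" "x \<in> U" "x' \<in> U" for i U x x'
    proof (cases "U = M i")
      case True
      then have "near G ((R + r) + (R + r)) x x'"
        using U by (intro near_trans[OF Mz[OF i] near_sym[OF Mz[OF i]]]) auto
      then show ?thesis
        by (simp add: algebra_simps)
    next
      case False
      then have "near G R x x'"
        using U by (intro near_of_delete_verts[OF diam[OF i]]) (auto simp: \<V>_def)
      then show ?thesis
        using assms(2,3) by (auto intro: near_mono)
    qed
  qed
qed

section \<open>Induction on the number of deleted vertices\<close>

lemma delete_verts_empty: "delete_verts G {} = G"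
  by (cases G) (simp add: delete_verts_def)

lemma delete_verts_delete_verts:
  "delete_verts (delete_verts G Y) Z = delete_verts G (Y \<union> Z)"
  by (auto simp: delete_verts_def)

lemma pair_graph_delete_verts:
  assumes "pair_graph G"
  shows "pair_graph (delete_verts G Z)"
proof -
  interpret pair_graph G by (rule assms)
  interpret D: pair_wf_digraph "delete_verts G Z" by (rule pair_wf_digraph_delete_verts)
  show ?thesis
  proof
    show "finite (pverts (delete_verts G Z))"
      by (simp add: delete_verts_def)
    show "finite (parcs (delete_verts G Z))"
      by (rule finite_subset[OF _ pair_finite_arcs]) (auto simp: delete_verts_def)
    show "fst e \<noteq> snd e" if "e \<in> parcs (delete_verts G Z)" for e
      using that no_loops by (auto simp: delete_verts_def)
    show "symmetric (delete_verts G Z)"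
      using arcs_symmetric by (auto simp: symmetric_def delete_verts_def intro!: symI)
  qed
qed

lemma subset_plus_class:
  assumes "\<And>G. G \<in> \<F> \<Longrightarrow> pair_graph G"
  shows "\<F> \<subseteq> \<F>\<^bsup>+n\<^esup>"
  using assms by (auto simp: plus_class_def delete_verts_empty intro!: exI[of _ "{}"])

text \<open>If the deleted set is nonempty, one of its vertices can be removed first, leaving at
  most \<open>n\<close> others.\<close>

lemma plus_class_Suc_cases:
  assumes "G \<in> \<F>\<^bsup>+Suc n\<^esup>"
  obtains "G \<in> \<F>\<^bsup>+n\<^esup>" | z where "z \<in> pverts G" "delete_verts G {z} \<in> \<F>\<^bsup>+n\<^esup>"
proof -
  obtain Z where G: "pair_graph G" and Z: "Z \<subseteq> pverts G" "card Z \<le> Suc n" "delete_verts G Z \<in> \<F>"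
    using assms by (auto simp: plus_class_def)
  show thesis
  proof (cases "Z = {}")
    case True
    then show thesis
      using G Z by (intro that(1)) (auto simp: plus_class_def intro!: exI[of _ "{}"])
  next
    case False
    then obtain z where z: "z \<in> Z"
      by blast
    have "delete_verts (delete_verts G {z}) (Z - {z}) \<in> \<F>"
      using Z(3) z by (simp add: delete_verts_delete_verts insert_absorb)
    moreover have "Z - {z} \<subseteq> pverts (delete_verts G {z})"
      using Z(1) by (auto simp: delete_verts_def)
    moreover have "card (Z - {z}) \<le> n"
      using Z(2) z by simp
    ultimately have "delete_verts G {z} \<in> \<F>\<^bsup>+n\<^esup>"
      using pair_graph_delete_verts[OF G] by (auto simp: plus_class_def)
    then show thesis
      using that(2) z Z(1) by blast
  qed
qed

lemma control_function_plus_class: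
  assumes "control_function m \<F> f"
  shows "\<exists>g. control_function m (\<F>\<^bsup>+n\<^esup>) g"
proof (induction n)
  case 0
  have "\<F>\<^bsup>+0\<^esup> \<subseteq> \<F>"
  proof
    fix G assume "G \<in> \<F>\<^bsup>+0\<^esup>"
    then obtain Z where "pair_graph G" "Z \<subseteq> pverts G" "card Z = 0" "delete_verts G Z \<in> \<F>"
      by (auto simp: plus_class_def)
    \<comment> \<open>\<open>card\<close> is also 0 on infinite sets, so the finiteness of
      \<open>G\<close> enters here.\<close>
    moreover from this have "Z = {}"
      using pair_fin_digraph.pair_finite_verts[of G]
      by (metis card_0_eq finite_subset pair_digraph_def pair_graph_def)
    ultimately show "G \<in> \<F>"
      by (simp add: delete_verts_empty)
  qed
  then show ?case
    using assms unfolding control_function_iff_has_cover by blast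
next
  case (Suc n)
  then obtain g where pos: "\<And>r. r > 0 \<Longrightarrow> g r > 0"
      and cover: "\<And>G r. G \<in> \<F>\<^bsup>+n\<^esup> \<Longrightarrow> r > 0 \<Longrightarrow> has_cover m G r (g r)"
    unfolding control_function_iff_has_cover by blast
  have "has_cover m G r (2 * g r + 2 * r)" if G: "G \<in> \<F>\<^bsup>+Suc n\<^esup>" and r: "r > 0" for G r
    using G
  proof (cases rule: plus_class_Suc_cases)
    case 1
    then show ?thesis
      using cover[OF 1 r] pos[OF r] r by (auto intro: has_cover_mono)
  next
    case (2 z)
    interpret pair_graph G
      using G by (simp add: plus_class_def)
    show ?thesis
      using has_cover_restore_vertex[OF 2(1) _ _ cover[OF 2(2) r]] pos[OF r] r by simp
  qed
  then show ?case
    unfolding control_function_iff_has_cover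
    by (intro exI[of _ "\<lambda>r. 2 * g r + 2 * r"]) (simp add: pos add_pos_pos)
qed

theorem theorem4p3:
  fixes \<F> :: "'a pair_pre_digraph set" and n :: nat
  assumes "\<And>G. G \<in> \<F> \<Longrightarrow> pair_graph G"
  shows "asymptotic_dimension (\<F>\<^bsup>+n\<^esup>) = asymptotic_dimension \<F>"
proof -
  have "control_function m \<F> f" if "control_function m (\<F>\<^bsup>+n\<^esup>) f" for m f
    using that subset_plus_class[OF assms, of \<F>] unfolding control_function_iff_has_cover by blast
  \<comment> \<open>The two classes admit control functions in the same dimensions, though with
    different functions, so both infima range over the same set.\<close>
  then have "(\<exists>f. control_function m (\<F>\<^bsup>+n\<^esup>) f) \<longleftrightarrow> (\<exists>f. control_function m \<F> f)" for m
    using control_function_plus_class by blast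
  then show ?thesis
    unfolding asymptotic_dimension_def by simp
qed

end
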